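(* Let $(M,R)$ be a strongly minimal Steiner system $M\models T^S_\mu$ with line length at least four. Then no binary operation $*$ on $M$ satisfying: for all $a,b\in M$, $a*b$ lies on the line through $a$ and $b$, and $*$ is a quasigroup whose restriction to each line is generated by any two elements of the line, is definable in $(M,R)$.
   Context: A quasigroup is a binary operation such that for all $x,y$ there are unique $l,r$ with $lx=y$ and $xr=y$. $T^S_\mu$ is a strongly minimal Steiner system theory in the vocabulary of one ternary collinearity relation $R$ (a 3-hypergraph): models are linear spaces (any two points on a unique line, lines being maximal $R$-cliques) all of whose lines have $\mu(\boldsymbol\alpha)+2$ points, obtained as the theory of the generic of the class of finite linear spaces $A$ with hereditarily nonnegative predimension $\delta(A)=|A|-\sum_\ell(|\ell|-2)$ in which each good pair $A/B$ has at most $\mu(A/B)$ disjoint copies over $B$; here $\boldsymbol\alpha$ is the good pair $(\{b_1,b_2\},\{a\})$ with $R(b_1,b_2,a)$. Line length at least four means $\mu(\boldsymbol\alpha)\ge 2$. *)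

theory Defs
  imports Main "HOL-Library.Countable_Set" "HOL-Library.Disjoint_Sets"
begin

text \<open>
  A structure for one ternary relation symbol is given by a carrier V and a relation R;
  only the values of R on V matter. The induced substructure on A \<subseteq> V is (A, R).
\<close>

type_synonym 'a rel3 = "'a \<Rightarrow> 'a \<Rightarrow> 'a \<Rightarrow> bool"

datatype fm =
    Eq nat nat
  | Rel nat nat nat
  | Neg fm
  | Conj fm fm
  | Ex nat fm

primrec fv :: "fm \<Rightarrow> nat set" where
  "fv (Eq i j) = {i, j}"
| "fv (Rel i j k) = {i, j, k}"
| "fv (Neg p) = fv p"
| "fv (Conj p q) = fv p \<union> fv q"
| "fv (Ex i p) = fv p - {i}"

primrec sat :: "'a set \<Rightarrow> 'a rel3 \<Rightarrow> (nat \<Rightarrow> 'a) \<Rightarrow> fm \<Rightarrow> bool" where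
  "sat V R s (Eq i j) \<longleftrightarrow> s i = s j"
| "sat V R s (Rel i j k) \<longleftrightarrow> R (s i) (s j) (s k)"
| "sat V R s (Neg p) \<longleftrightarrow> \<not> sat V R s p"
| "sat V R s (Conj p q) \<longleftrightarrow> sat V R s p \<and> sat V R s q"
| "sat V R s (Ex i p) \<longleftrightarrow> (\<exists>a\<in>V. sat V R (s(i := a)) p)"

definition holds :: "'a set \<Rightarrow> 'a rel3 \<Rightarrow> fm \<Rightarrow> bool" where
  "holds V R p \<longleftrightarrow> (\<forall>s. range s \<subseteq> V \<longrightarrow> sat V R s p)"

definition theory_of :: "'a set \<Rightarrow> 'a rel3 \<Rightarrow> fm set" where
  "theory_of V R = {p. fv p = {} \<and> holds V R p}"

definition is_model :: "'a set \<Rightarrow> 'a rel3 \<Rightarrow> fm set \<Rightarrow> bool" where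
  "is_model V R T \<longleftrightarrow> V \<noteq> {} \<and> (\<forall>p\<in>T. holds V R p)"

text \<open>
  Definability is with parameters: they are the values under s of the variables other than
  the displayed ones.
\<close>

definition definable_set :: "'a set \<Rightarrow> 'a rel3 \<Rightarrow> 'a set \<Rightarrow> bool" where
  "definable_set V R X \<longleftrightarrow>
     (\<exists>p s. range s \<subseteq> V \<and> X = {x \<in> V. sat V R (s(0 := x)) p})"

definition definable_op :: "'a set \<Rightarrow> 'a rel3 \<Rightarrow> ('a \<Rightarrow> 'a \<Rightarrow> 'a) \<Rightarrow> bool" where
  "definable_op V R f \<longleftrightarrow>
     (\<exists>p s. range s \<subseteq> V \<and>
        (\<forall>a\<in>V. \<forall>b\<in>V. \<forall>c\<in>V. f a b = c \<longleftrightarrow> sat V R (s(0 := a, 1 := b, 2 := c)) p))"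

definition minimal_structure :: "'a set \<Rightarrow> 'a rel3 \<Rightarrow> bool" where
  "minimal_structure V R \<longleftrightarrow>
     infinite V \<and> (\<forall>X. definable_set V R X \<longrightarrow> finite X \<or> finite (V - X))"

text \<open>
  Strong minimality asks that every elementarily equivalent structure be minimal. As the
  vocabulary is countable, by Loewenheim-Skolem it suffices to quantify over countable
  structures, that is, those with carrier a set of natural numbers.
\<close>

definition strongly_minimal :: "'a set \<Rightarrow> 'a rel3 \<Rightarrow> bool" where
  "strongly_minimal V R \<longleftrightarrow>
     minimal_structure V R \<and>
     (\<forall>(N :: nat set) S. is_model N S (theory_of V R) \<longrightarrow> minimal_structure N S)"

definition hypergraph3 :: "'a set \<Rightarrow> 'a rel3 \<Rightarrow> bool" where
  "hypergraph3 V R \<longleftrightarrow>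
     (\<forall>x\<in>V. \<forall>y\<in>V. \<forall>z\<in>V. R x y z \<longrightarrow> distinct [x, y, z] \<and> R y x z \<and> R x z y)"

definition clique :: "'a rel3 \<Rightarrow> 'a set \<Rightarrow> bool" where
  "clique R X \<longleftrightarrow> (\<forall>x\<in>X. \<forall>y\<in>X. \<forall>z\<in>X. distinct [x, y, z] \<longrightarrow> R x y z)"

text \<open>
  Every two-element set is vacuously a clique, so two points not collinear with any third
  form a line. The condition of having two points only matters if V has at most one point.
\<close>

definition is_line :: "'a set \<Rightarrow> 'a rel3 \<Rightarrow> 'a set \<Rightarrow> bool" where
  "is_line V R l \<longleftrightarrow>
     l \<subseteq> V \<and> clique R l \<and> (\<exists>x\<in>l. \<exists>y\<in>l. x \<noteq> y) \<and>
     (\<forall>l'. l \<subseteq> l' \<and> l' \<subseteq> V \<and> clique R l' \<longrightarrow> l' = l)"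

definition linear_space :: "'a set \<Rightarrow> 'a rel3 \<Rightarrow> bool" where
  "linear_space V R \<longleftrightarrow>
     hypergraph3 V R \<and>
     (\<forall>x\<in>V. \<forall>y\<in>V. x \<noteq> y \<longrightarrow> (\<exists>!l. is_line V R l \<and> x \<in> l \<and> y \<in> l))"

definition steiner_system :: "nat \<Rightarrow> 'a set \<Rightarrow> 'a rel3 \<Rightarrow> bool" where
  "steiner_system k V R \<longleftrightarrow>
     linear_space V R \<and> (\<forall>l. is_line V R l \<longrightarrow> finite l \<and> card l = k)"

definition predim :: "'a rel3 \<Rightarrow> 'a set \<Rightarrow> int" where
  "predim R A = int (card A) - (\<Sum>l | is_line A R l. int (card l) - 2)"

definition in_K0 :: "'a set \<Rightarrow> 'a rel3 \<Rightarrow> bool" where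
  "in_K0 A R \<longleftrightarrow> finite A \<and> linear_space A R \<and> (\<forall>A'\<subseteq>A. 0 \<le> predim R A')"

definition strong_in :: "'a rel3 \<Rightarrow> 'a set \<Rightarrow> 'a set \<Rightarrow> bool" where
  "strong_in R B V \<longleftrightarrow>
     B \<subseteq> V \<and> (\<forall>C. finite C \<and> B \<subseteq> C \<and> C \<subseteq> V \<longrightarrow> predim R B \<le> predim R C)"

text \<open>In the following, B is the base and A the extension, i.e. the pair written A/B.\<close>

definition zero_primitive :: "'a set \<Rightarrow> 'a set \<Rightarrow> 'a rel3 \<Rightarrow> bool" where
  "zero_primitive B A S \<longleftrightarrow>
     in_K0 (B \<union> A) S \<and> A \<inter> B = {} \<and> A \<noteq> {} \<and>
     strong_in S B (B \<union> A) \<and> predim S (B \<union> A) = predim S B \<and>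
     \<not> (\<exists>C. B \<subset> C \<and> C \<subset> B \<union> A \<and> strong_in S B C \<and> strong_in S C (B \<union> A))"

definition good_pair :: "'a set \<Rightarrow> 'a set \<Rightarrow> 'a rel3 \<Rightarrow> bool" where
  "good_pair B A S \<longleftrightarrow>
     zero_primitive B A S \<and> \<not> (\<exists>B'. B' \<subset> B \<and> zero_primitive B' A S)"

definition embedding :: "('a \<Rightarrow> 'b) \<Rightarrow> 'a set \<Rightarrow> 'a rel3 \<Rightarrow> 'b set \<Rightarrow> 'b rel3 \<Rightarrow> bool" where
  "embedding h A S V R \<longleftrightarrow>
     inj_on h A \<and> h ` A \<subseteq> V \<and>
     (\<forall>x\<in>A. \<forall>y\<in>A. \<forall>z\<in>A. S x y z \<longleftrightarrow> R (h x) (h y) (h z))"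

text \<open>
  Isomorphism types of finite pairs are represented by pairs on sets of natural numbers;
  the function mu must therefore be invariant under isomorphism of good pairs.
\<close>

type_synonym mu_fun = "nat set \<Rightarrow> nat set \<Rightarrow> nat rel3 \<Rightarrow> nat"

definition iso_invariant :: "mu_fun \<Rightarrow> bool" where
  "iso_invariant mu \<longleftrightarrow>
     (\<forall>B A S B' A' S' h.
        good_pair B A S \<and> good_pair B' A' S' \<and>
        embedding h (B \<union> A) S (B' \<union> A') S' \<and> h ` B = B' \<and> h ` A = A'
        \<longrightarrow> mu B A S = mu B' A' S')"

text \<open>The value of mu at the good pair ({b1, b2}, {a}) with R(b1, b2, a).\<close>

definition mu_alpha :: "mu_fun \<Rightarrow> nat" where
  "mu_alpha mu = mu {0, 1} {2} (\<lambda>x y z. {x, y, z} = {0, 1, 2})"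

definition is_copy ::
  "nat set \<Rightarrow> nat set \<Rightarrow> nat rel3 \<Rightarrow> (nat \<Rightarrow> 'a) \<Rightarrow> 'a set \<Rightarrow> 'a rel3 \<Rightarrow> 'a set \<Rightarrow> bool" where
  "is_copy B A S f V R A' \<longleftrightarrow>
     (\<exists>g. embedding g (B \<union> A) S V R \<and> (\<forall>b\<in>B. g b = f b) \<and> A' = g ` A)"

text \<open>Here f places the base B inside the structure, and F is a family of disjoint copies over it.\<close>

definition in_Kmu :: "mu_fun \<Rightarrow> 'a set \<Rightarrow> 'a rel3 \<Rightarrow> bool" where
  "in_Kmu mu V R \<longleftrightarrow>
     in_K0 V R \<and>
     (\<forall>B A S f F.
        good_pair B A S \<and> (\<forall>A'\<in>F. is_copy B A S f V R A') \<and> disjoint F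
        \<longrightarrow> finite F \<and> card F \<le> mu B A S)"

definition is_generic :: "mu_fun \<Rightarrow> 'a set \<Rightarrow> 'a rel3 \<Rightarrow> bool" where
  "is_generic mu V R \<longleftrightarrow>
     countable V \<and>
     (\<forall>A. finite A \<and> A \<subseteq> V \<longrightarrow>
        in_Kmu mu A R \<and> (\<exists>C. finite C \<and> A \<subseteq> C \<and> strong_in R C V)) \<and>
     (\<forall>A (B :: nat set) S f.
        finite A \<and> strong_in R A V \<and> in_Kmu mu B S \<and>
        embedding f A R B S \<and> strong_in S (f ` A) B \<longrightarrow>
        (\<exists>g. embedding g B S V R \<and> (\<forall>a\<in>A. g (f a) = a) \<and> strong_in R (g ` B) V))"

definition quasigroup_on :: "'a set \<Rightarrow> ('a \<Rightarrow> 'a \<Rightarrow> 'a) \<Rightarrow> bool" where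
  "quasigroup_on V f \<longleftrightarrow>
     (\<forall>x\<in>V. \<forall>y\<in>V. f x y \<in> V) \<and>
     (\<forall>x\<in>V. \<forall>y\<in>V. (\<exists>!l. l \<in> V \<and> f l x = y) \<and> (\<exists>!r. r \<in> V \<and> f x r = y))"

inductive_set generated :: "('a \<Rightarrow> 'a \<Rightarrow> 'a) \<Rightarrow> 'a set \<Rightarrow> 'a set"
  for f :: "'a \<Rightarrow> 'a \<Rightarrow> 'a" and X :: "'a set" where
  base: "x \<in> X \<Longrightarrow> x \<in> generated f X"
| mult: "x \<in> generated f X \<Longrightarrow> y \<in> generated f X \<Longrightarrow> f x y \<in> generated f X"

end

theory Submission
  imports Defs
begin

text \<open>
  Such an operation is idempotent, because two lines through a point meet only there, so by
  cancellation it sends distinct a, b to a third point of their line. If it were definable, the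
  sentence saying that some parameters define a choice of a third point on every line, each line
  having at least two to choose from, would pass to the generic structure. There, adjoin to a finite
  strong set containing the parameters two points a, b in no collinear triple. All further points of
  the line ab then have the same type over the parameters and a, b, as isomorphisms between finite
  strong subsets form a back-and-forth system; so none of them can be singled out.
\<close>

section \<open>Linear spaces and their lines\<close>

text \<open>Amalgamation over finite strong sets belongs to the definition of the generic structure
  and is not assumed of M; this is why the argument changes structures. A sentence cannot mention
  parameters, so they are quantified away, and the generic structure may supply any values for them:
  \<open>a\<close> and \<open>b\<close> must be found over an arbitrary finite set. Two facts make
  such a pair usable. Good pairs have no isolated points, so adjoining an isolated point creates no
  new copy of a good pair and the bounds given by \<mu> survive. And a new point costs one unit of
  predimension for each line that it joins. If X is strong and {a, b} is a line of X, a further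
  point of that line therefore joins this line only and leaves the predimension unchanged: the
  enlarged set is strong again, and its isomorphism type over X is determined. Line length at least
  four enters as a second candidate next to the product of a and b, so the sentence need not fix the
  number of points on a line.\<close>

definition collinear_exchange :: "'a set \<Rightarrow> 'a rel3 \<Rightarrow> bool" where
  "collinear_exchange V R \<longleftrightarrow> hypergraph3 V R \<and>
     (\<forall>x\<in>V. \<forall>y\<in>V. \<forall>z\<in>V. \<forall>w\<in>V. R x y z \<and> R x y w \<and> z \<noteq> w \<longrightarrow> R x z w)"

definition line_through :: "'a set \<Rightarrow> 'a rel3 \<Rightarrow> 'a \<Rightarrow> 'a \<Rightarrow> 'a set" where
  "line_through V R x y = {x, y} \<union> {z \<in> V. R x y z}"

lemma hypergraph3D:
  assumes "hypergraph3 V R" "R x y z" "x \<in> V" "y \<in> V" "z \<in> V"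
  shows "x \<noteq> y" "x \<noteq> z" "y \<noteq> z" "R y x z" "R x z y" "R y z x" "R z x y" "R z y x"
proof -
  have *: "distinct [x, y, z] \<and> R y x z \<and> R x z y"
    if "R x y z" "x \<in> V" "y \<in> V" "z \<in> V" for x y z
    using assms(1) that unfolding hypergraph3_def by blast
  show "x \<noteq> y" "x \<noteq> z" "y \<noteq> z" "R y x z" "R x z y"
    using *[OF assms(2-5)] by auto
  then show "R y z x" "R z x y"
    using * assms(3-5) by blast+
  then show "R z y x"
    using * assms(3-5) by blast
qed

lemma hypergraph3_subset: "hypergraph3 V R \<Longrightarrow> W \<subseteq> V \<Longrightarrow> hypergraph3 W R"
  unfolding hypergraph3_def by blast

text \<open>Being a universal condition, exchange passes to every subset. The definition of a linear
  space speaks of maximal cliques, which change with the carrier. On finite carriers the two notions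
  coincide, so lines of subspaces are handled through exchange.\<close>

lemma collinear_exchange_subset:
  "collinear_exchange V R \<Longrightarrow> W \<subseteq> V \<Longrightarrow> collinear_exchange W R"
  unfolding collinear_exchange_def using hypergraph3_subset by blast

lemma cliqueD:
  "clique R l \<Longrightarrow> x \<in> l \<Longrightarrow> y \<in> l \<Longrightarrow> z \<in> l \<Longrightarrow> x \<noteq> y \<Longrightarrow> x \<noteq> z \<Longrightarrow> y \<noteq> z \<Longrightarrow> R x y z"
  unfolding clique_def by simp

lemma clique_triple:
  assumes "hypergraph3 V R" "R x y z" "x \<in> V" "y \<in> V" "z \<in> V"
  shows "clique R {x, y, z}"
  using hypergraph3D[OF assms] assms(2) unfolding clique_def by auto

lemma clique_extends_to_line:
  assumes "finite V" "l \<subseteq> V" "clique R l" "x \<in> l" "y \<in> l" "x \<noteq> y"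
  obtains k where "is_line V R k" "l \<subseteq> k"
proof -
  let ?K = "{k. k \<subseteq> V \<and> clique R k}"
  have "finite ?K" using assms(1) by simp
  moreover have "l \<in> ?K" using assms by blast
  ultimately obtain m where m: "m \<in> ?K" "l \<subseteq> m" "\<forall>b\<in>?K. m \<subseteq> b \<longrightarrow> m = b"
    using finite_has_maximal2[of ?K l] by blast
  then have "is_line V R m"
    unfolding is_line_def using assms by blast
  with m(2) that show thesis by blast
qed

text \<open>Uniqueness of the line through x and y forces the lines extending {x, y, z} and {x, y,
  w} to coincide. Finiteness supplies maximal cliques containing these triples.\<close>

lemma linear_space_collinear_exchange:
  assumes "finite V" "linear_space V R"
  shows "collinear_exchange V R"
proof -
  have hyp: "hypergraph3 V R" using assms(2) by (simp add: linear_space_def)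
  have "R x z w"
    if V: "x \<in> V" "y \<in> V" "z \<in> V" "w \<in> V" and R: "R x y z" "R x y w" "z \<noteq> w" for x y z w
  proof -
    note d = hypergraph3D[OF hyp R(1) V(1-3)] hypergraph3D[OF hyp R(2) V(1,2,4)]
    obtain k where k: "is_line V R k" "{x, y, z} \<subseteq> k"
      using clique_extends_to_line[OF assms(1) _ clique_triple[OF hyp R(1) V(1-3)], of x y] V d
      by blast
    obtain m where m: "is_line V R m" "{x, y, w} \<subseteq> m"
      using clique_extends_to_line[OF assms(1) _ clique_triple[OF hyp R(2) V(1,2,4)], of x y] V d
      by blast
    have "\<exists>!l. is_line V R l \<and> x \<in> l \<and> y \<in> l"
      using assms(2) V d unfolding linear_space_def by blast
    then have "k = m" using k m by blast
    then have "clique R k" "x \<in> k" "z \<in> k" "w \<in> k" using k m by (auto simp: is_line_def)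
    then show "R x z w" using d R(3) unfolding clique_def by auto
  qed
  then show ?thesis using hyp unfolding collinear_exchange_def by blast
qed

text \<open>Exchange makes this set a clique: it gives the triples containing x, and a triple u, z,
  w avoiding x then follows from the two collinearities of u and x with z and with w. Every clique
  through x and y lies inside the set, so it is the greatest such clique and hence the only maximal
  one.\<close>

lemma line_through_props:
  assumes "collinear_exchange V R" "x \<in> V" "y \<in> V" "x \<noteq> y"
  shows "is_line V R (line_through V R x y)"
    and "\<And>l. is_line V R l \<Longrightarrow> x \<in> l \<Longrightarrow> y \<in> l \<Longrightarrow> l = line_through V R x y"
proof -
  let ?l = "line_through V R x y"
  have hyp: "hypergraph3 V R" using assms(1) by (simp add: collinear_exchange_def)
  note sym = hypergraph3D[OF hyp]
  have exch: "R x z w"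
    if "R x y z" "R x y w" "z \<noteq> w" "x \<in> V" "y \<in> V" "z \<in> V" "w \<in> V" for x y z w
    using assms(1) that unfolding collinear_exchange_def by blast
  have xz: "R x z w" if "z \<in> ?l" "w \<in> ?l" "z \<noteq> x" "w \<noteq> x" "z \<noteq> w" for z w
    using that exch[of x y z w] sym[of x y] assms unfolding line_through_def by auto
  have sub: "?l \<subseteq> V" using assms by (auto simp: line_through_def)
  have clq: "clique R ?l"
    unfolding clique_def
  proof (intro ballI impI)
    fix u z w assume *: "u \<in> ?l" "z \<in> ?l" "w \<in> ?l" "distinct [u, z, w]"
    have inV: "u \<in> V" "z \<in> V" "w \<in> V" using * sub by auto
    consider "u = x" | "z = x" | "w = x" | "u \<noteq> x" "z \<noteq> x" "w \<noteq> x" by blast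
    then show "R u z w"
    proof cases
      case 1 then show ?thesis using xz[of z w] * by auto
    next
      case 2 then show ?thesis using xz[of u w] * sym(4)[of x u w] assms(2) inV by auto
    next
      case 3 then show ?thesis using xz[of u z] * sym(6)[of x u z] assms(2) inV by auto
    next
      case 4
      then have "R x u z" "R x u w" using xz * by auto
      then have "R u x z" "R u x w" using sym(4) assms(2) inV by blast+
      then show ?thesis using exch[of u x z w] * inV assms(2) by auto
    qed
  qed
  have below: "l \<subseteq> ?l" if "clique R l" "l \<subseteq> V" "x \<in> l" "y \<in> l" for l
    using that assms(4) unfolding clique_def line_through_def by auto
  show "is_line V R ?l"
    unfolding is_line_def
    using sub clq below assms(4) by (auto simp: line_through_def)
  show "l = ?l" if "is_line V R l" "x \<in> l" "y \<in> l" for l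
    using that below[of l] sub clq unfolding is_line_def by blast
qed

lemma linear_space_if_collinear_exchange:
  "collinear_exchange V R \<Longrightarrow> linear_space V R"
  unfolding linear_space_def
proof (intro conjI ballI impI)
  fix x y assume *: "collinear_exchange V R" "x \<in> V" "y \<in> V" "x \<noteq> y"
  show "\<exists>!l. is_line V R l \<and> x \<in> l \<and> y \<in> l"
  proof (rule ex1I)
    show "is_line V R (line_through V R x y) \<and> x \<in> line_through V R x y \<and> y \<in> line_through V R x y"
      using line_through_props(1)[OF *] by (simp add: line_through_def)
  qed (use line_through_props(2)[OF *] in blast)
qed (simp add: collinear_exchange_def)

lemma is_lineE:
  assumes "collinear_exchange V R" "is_line V R l"
  obtains x y where "x \<in> V" "y \<in> V" "x \<noteq> y" "l = line_through V R x y"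
proof -
  obtain x y where "x \<in> l" "y \<in> l" "x \<noteq> y" "l \<subseteq> V" using assms(2) unfolding is_line_def by blast
  with that line_through_props(2)[OF assms(1) _ _ _ assms(2)] show thesis by blast
qed

lemma finite_lines: "finite V \<Longrightarrow> finite {l. is_line V R l}"
  by (rule finite_subset[of _ "Pow V"]) (auto simp: is_line_def)

section \<open>Predimension of one-point extensions\<close>

text \<open>Each such line is one dependency of c over X. A single pair collinear with c suffices,
  since exchange then puts c on the whole line; lines with only two points in X count as
  well.\<close>

definition extended_lines :: "'a rel3 \<Rightarrow> 'a set \<Rightarrow> 'a \<Rightarrow> 'a set set" where
  "extended_lines R X c = {l. is_line X R l \<and> (\<exists>x\<in>l. \<exists>y\<in>l. R x y c)}"

text \<open>The point itself contributes 1, and each line that it joins has its weight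
  \<open>card l - 2\<close> raised by 1. A line of the larger space with only one point in X
  consists of that point and c and has weight 0; all other lines stay as they were.\<close>

lemma predim_insert:
  assumes fin: "finite X" and c: "c \<notin> X" and ce: "collinear_exchange (insert c X) R"
  shows "predim R (insert c X) = predim R X + 1 - int (card (extended_lines R X c))"
proof -
  let ?V = "insert c X"
  let ?E = "extended_lines R X c"
  let ?N = "{l. is_line X R l} - ?E"
  let ?T = "{l. is_line ?V R l \<and> card l = 2 \<and> c \<in> l}"
  have ceX: "collinear_exchange X R" using collinear_exchange_subset[OF ce] by blast
  have hyp: "hypergraph3 ?V R" using ce by (simp add: collinear_exchange_def)
  note sym = hypergraph3D[OF hyp]
  have finE: "finite ?E" and finN: "finite ?N"
    using finite_lines[OF fin, of R] by (auto simp: extended_lines_def)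
  have EX: "c \<notin> l" if "is_line X R l" for l using that c by (auto simp: is_line_def)
  \<comment> \<open>For the converse direction, the line of the larger space through the given pair
    u, v contains both c and the whole old line.\<close>
  have ext_iff: "line_through X R x y \<in> ?E \<longleftrightarrow> R x y c"
    if xy: "x \<in> X" "y \<in> X" "x \<noteq> y" for x y
  proof
    assume "R x y c" then show "line_through X R x y \<in> ?E"
      using line_through_props(1)[OF ceX xy] by (auto simp: extended_lines_def line_through_def)
  next
    assume "line_through X R x y \<in> ?E"
    then obtain u v where uv: "u \<in> line_through X R x y" "v \<in> line_through X R x y" "R u v c"
      by (auto simp: extended_lines_def)
    have sub: "line_through X R x y \<subseteq> X" using xy by (auto simp: line_through_def)
    have uvX: "u \<in> X" "v \<in> X" "u \<noteq> v" using uv sub sym(1)[OF uv(3)] by auto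
    have "is_line X R (line_through X R x y)" by (rule line_through_props(1)[OF ceX xy])
    then have clq: "clique R (line_through X R x y)" by (simp add: is_line_def)
    have "clique R (line_through ?V R u v)"
      using line_through_props(1)[OF ce, of u v] uvX by (auto simp: is_line_def)
    moreover have "x \<in> line_through ?V R u v" "y \<in> line_through ?V R u v"
      using cliqueD[OF clq uv(1,2)] uvX xy by (auto simp: line_through_def)
    moreover have "c \<in> line_through ?V R u v" using uv by (auto simp: line_through_def)
    ultimately show "R x y c" using cliqueD xy c by metis
  qed
  have thru: "line_through ?V R x y =
      (if R x y c then insert c (line_through X R x y) else line_through X R x y)" for x y
    by (auto simp: line_through_def)
  have lines: "{l. is_line ?V R l} = ?N \<union> (insert c ` ?E \<union> ?T)"
  proof (intro set_eqI iffI)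
    fix l assume "l \<in> {l. is_line ?V R l}"
    then have l: "is_line ?V R l" by simp
    have main: "l \<in> ?N \<union> (insert c ` ?E \<union> ?T)" if "x \<in> X" "y \<in> X" "x \<noteq> y" "x \<in> l" "y \<in> l" for x y
    proof -
      have "l = line_through ?V R x y"
        using line_through_props(2)[OF ce _ _ _ l, of x y] that by auto
      then show ?thesis
        using thru[of x y] ext_iff[of x y] line_through_props(1)[OF ceX, of x y] that by auto
    qed
    obtain u v where uv: "u \<in> ?V" "v \<in> ?V" "u \<noteq> v" "u \<in> l" "v \<in> l" "l = line_through ?V R u v"
      using is_lineE[OF ce l] by (metis UnI1 insertI1 insert_commute line_through_def)
    show "l \<in> ?N \<union> (insert c ` ?E \<union> ?T)"
    proof (cases "\<exists>x\<in>X. \<exists>y\<in>X. x \<noteq> y \<and> x \<in> l \<and> y \<in> l")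
      case True then show ?thesis using main by blast
    next
      case False
      have "l \<subseteq> ?V" using l by (simp add: is_line_def)
      then have "l = {u, v}" "c \<in> l" using False uv(1-5) by auto
      then have "l \<in> ?T" using l uv(3) by auto
      then show ?thesis by blast
    qed
  next
    fix l assume "l \<in> ?N \<union> (insert c ` ?E \<union> ?T)"
    then consider k where "is_line X R k" "k \<notin> ?E" "l = k" | k where "k \<in> ?E" "l = insert c k"
      | "l \<in> ?T" by blast
    then show "l \<in> {l. is_line ?V R l}"
    proof cases
      case 1
      obtain x y where xy: "x \<in> X" "y \<in> X" "x \<noteq> y" "k = line_through X R x y"
        using is_lineE[OF ceX 1(1)] .
      then have "k = line_through ?V R x y" using 1 ext_iff thru by auto
      then show ?thesis using line_through_props(1)[OF ce, of x y] xy 1 by auto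
    next
      case 2
      then have "is_line X R k" by (simp add: extended_lines_def)
      then obtain x y where xy: "x \<in> X" "y \<in> X" "x \<noteq> y" "k = line_through X R x y"
        by (rule is_lineE[OF ceX])
      then have "l = line_through ?V R x y" using 2 ext_iff thru by auto
      then show ?thesis using line_through_props(1)[OF ce, of x y] xy by auto
    qed auto
  qed
  have injE: "inj_on (insert c) ?E"
  proof (rule inj_onI)
    fix k l assume "k \<in> ?E" "l \<in> ?E" "insert c k = insert c l"
    moreover from this have "c \<notin> k" "c \<notin> l" using EX by (auto simp: extended_lines_def)
    ultimately show "k = l" by (simp add: insert_ident)
  qed
  have big: "card l > 2" if l: "l \<in> insert c ` ?E" for l
  proof -
    obtain k x y where k: "k \<in> ?E" "l = insert c k" "x \<in> k" "y \<in> k" "R x y c"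
      using l unfolding extended_lines_def by blast
    then have kX: "k \<subseteq> X" by (auto simp: extended_lines_def is_line_def)
    then have "x \<noteq> y" using sym(1)[OF k(5)] k by auto
    have "finite k" using kX fin finite_subset by blast
    then have "card {c, x, y} \<le> card l" using k by (intro card_mono) auto
    moreover have "c \<noteq> x" "c \<noteq> y" using k(3,4) kX c by blast+
    then have "card {c, x, y} = 3" using \<open>x \<noteq> y\<close> by simp
    ultimately show ?thesis by simp
  qed
  have disj: "insert c ` ?E \<inter> ?T = {}"
  proof (rule ccontr)
    assume "insert c ` ?E \<inter> ?T \<noteq> {}"
    then obtain l where "l \<in> insert c ` ?E" "card l = 2" by blast
    then show False using big[of l] by simp
  qed
  have finT: "finite ?T" using finite_lines[of ?V R] fin by simp
  let ?w = "\<lambda>l. int (card l) - 2"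
  have "sum ?w {l. is_line ?V R l} = sum ?w ?N + sum ?w (insert c ` ?E \<union> ?T)"
    unfolding lines by (rule sum.union_disjoint) (use finN finE finT EX in auto)
  also have "sum ?w (insert c ` ?E \<union> ?T) = sum ?w (insert c ` ?E) + sum ?w ?T"
    by (rule sum.union_disjoint) (use finE finT disj in auto)
  also have "sum ?w ?T = 0" by (rule sum.neutral) auto
  also have "sum ?w (insert c ` ?E) = (\<Sum>l\<in>?E. ?w l + 1)"
    unfolding sum.reindex[OF injE] o_def
  proof (rule sum.cong)
    fix l assume "l \<in> ?E"
    then have "l \<subseteq> X" by (auto simp: extended_lines_def is_line_def)
    then have "finite l" "c \<notin> l" using fin c finite_subset by blast+
    then show "int (card (insert c l)) - 2 = int (card l) - 2 + 1" by simp
  qed simp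
  also have "\<dots> = sum ?w ?E + int (card ?E)" by (simp only: sum.distrib) simp
  finally have "sum ?w {l. is_line ?V R l} = sum ?w ?N + sum ?w ?E + int (card ?E)" by simp
  moreover have "sum ?w {l. is_line X R l} = sum ?w ?N + sum ?w ?E"
    by (rule sum.subset_diff) (use finite_lines[OF fin] in \<open>auto simp: extended_lines_def\<close>)
  ultimately show ?thesis using fin c by (simp add: predim_def)
qed

section \<open>Transport along embeddings\<close>

lemma inj_on_image_subset_image_iff:
  "inj_on h X \<Longrightarrow> a \<subseteq> X \<Longrightarrow> b \<subseteq> X \<Longrightarrow> h ` a \<subseteq> h ` b \<longleftrightarrow> a \<subseteq> b"
  by (blast dest: inj_onD)

lemma embedding_clique_image_iff:
  assumes "embedding h A S V R" "k \<subseteq> A"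
  shows "clique R (h ` k) \<longleftrightarrow> clique S k"
proof -
  have "S x y z \<longleftrightarrow> R (h x) (h y) (h z)" "h x = h y \<longleftrightarrow> x = y"
    if "x \<in> k" "y \<in> k" "z \<in> k" for x y z
    using assms that unfolding embedding_def by (blast dest: inj_onD)+
  then show ?thesis unfolding clique_def by simp
qed

lemma embedding_is_line_image_iff:
  assumes h: "embedding h A S V R" and k: "k \<subseteq> X" and X: "X \<subseteq> A"
  shows "is_line (h ` X) R (h ` k) \<longleftrightarrow> is_line X S k"
proof -
  have inj: "inj_on h X" using h X unfolding embedding_def by (blast intro: inj_on_subset)
  have iff: "h ` a \<subseteq> h ` b \<longleftrightarrow> a \<subseteq> b" "h ` a = h ` b \<longleftrightarrow> a = b" if "a \<subseteq> X" "b \<subseteq> X" for a b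
    using inj_on_image_subset_image_iff[OF inj that] inj_on_image_eq_iff[OF inj that] by auto
  have clq: "clique R (h ` a) \<longleftrightarrow> clique S a" if "a \<subseteq> X" for a
    using embedding_clique_image_iff[OF h] that X by blast
  have two: "(\<exists>x\<in>h ` k. \<exists>y\<in>h ` k. x \<noteq> y) \<longleftrightarrow> (\<exists>x\<in>k. \<exists>y\<in>k. x \<noteq> y)"
    using inj k by (auto simp: inj_on_eq_iff subset_iff)
  have "(\<forall>l'. h ` k \<subseteq> l' \<and> l' \<subseteq> h ` X \<and> clique R l' \<longrightarrow> l' = h ` k) \<longleftrightarrow>
      (\<forall>b\<subseteq>X. h ` k \<subseteq> h ` b \<and> clique R (h ` b) \<longrightarrow> h ` b = h ` k)"
    (is "?L \<longleftrightarrow> ?R")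
  proof
    show ?R if ?L using that by (simp add: image_mono)
    show ?L if ?R
    proof (intro allI impI)
      fix l' assume l': "h ` k \<subseteq> l' \<and> l' \<subseteq> h ` X \<and> clique R l'"
      then obtain b where "b \<subseteq> X" "l' = h ` b" by (auto simp: subset_image_iff)
      then show "l' = h ` k" using that l' by simp
    qed
  qed
  also have "\<dots> \<longleftrightarrow> (\<forall>l'. k \<subseteq> l' \<and> l' \<subseteq> X \<and> clique S l' \<longrightarrow> l' = k)"
    using iff(1)[OF k] iff(2)[OF _ k] clq by (simp add: conj_commute imp_conjL) blast
  finally show ?thesis unfolding is_line_def using two iff(1)[OF k order_refl] clq[OF k] by simp
qed

lemma embedding_lines_image:
  assumes "embedding h A S V R" "X \<subseteq> A"
  shows "{l. is_line (h ` X) R l} = (`) h ` {k. is_line X S k}"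
proof (intro set_eqI iffI)
  fix l assume l: "l \<in> {l. is_line (h ` X) R l}"
  then have "l \<subseteq> h ` X" by (simp add: is_line_def)
  then obtain k where "k \<subseteq> X" "l = h ` k" by (auto elim: subset_imageE)
  then show "l \<in> (`) h ` {k. is_line X S k}"
    using l embedding_is_line_image_iff[OF assms(1) _ assms(2)] by auto
next
  fix l assume "l \<in> (`) h ` {k. is_line X S k}"
  then obtain k where k: "is_line X S k" "l = h ` k" by auto
  then have "k \<subseteq> X" by (simp add: is_line_def)
  then show "l \<in> {l. is_line (h ` X) R l}"
    using k embedding_is_line_image_iff[OF assms(1) _ assms(2)] by auto
qed

lemma embedding_predim_image:
  assumes h: "embedding h A S V R" and X: "X \<subseteq> A"
  shows "predim R (h ` X) = predim S X"
proof -
  have inj: "inj_on h X" using h X unfolding embedding_def by (blast intro: inj_on_subset)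
  have inj2: "inj_on ((`) h) {k. is_line X S k}"
    by (rule inj_on_subset[OF inj_on_image_Pow[OF inj]]) (auto simp: is_line_def)
  have "card (h ` k) = card k" if "is_line X S k" for k
    using that inj by (intro card_image) (auto simp: is_line_def intro: inj_on_subset)
  then have "(\<Sum>l | is_line (h ` X) R l. int (card l) - 2) = (\<Sum>k | is_line X S k. int (card k) - 2)"
    unfolding embedding_lines_image[OF assms] sum.reindex[OF inj2] by simp
  then show ?thesis by (simp add: predim_def card_image[OF inj])
qed

lemma embedding_strong_image:
  assumes h: "embedding h A S V R" and "strong_in S B A"
  shows "strong_in R (h ` B) (h ` A)"
  unfolding strong_in_def
proof (intro conjI allI impI)
  have BA: "B \<subseteq> A" using assms(2) by (simp add: strong_in_def)
  then show "h ` B \<subseteq> h ` A" by blast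
  fix C assume C: "finite C \<and> h ` B \<subseteq> C \<and> C \<subseteq> h ` A"
  have inj: "inj_on h A" using h by (simp add: embedding_def)
  obtain D where D: "D \<subseteq> A" "C = h ` D" using C by (auto elim: subset_imageE)
  then have "B \<subseteq> D" using C inj_on_image_subset_image_iff[OF inj BA D(1)] by simp
  moreover have "finite D" using D C finite_imageD[OF _ inj_on_subset[OF inj D(1)]] by simp
  ultimately have "predim S B \<le> predim S D" using assms(2) D unfolding strong_in_def by blast
  then show "predim R (h ` B) \<le> predim R C"
    using embedding_predim_image[OF h BA] embedding_predim_image[OF h D(1)] D(2) by simp
qed

lemma embedding_comp:
  "embedding g A S V R \<Longrightarrow> embedding h V R W T \<Longrightarrow> embedding (h \<circ> g) A S W T"
  unfolding embedding_def
  by (intro conjI comp_inj_on inj_on_subset[of h V "g ` A"]) (auto simp: subset_iff)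

lemma embedding_codomain:
  "embedding g A S V R \<Longrightarrow> g ` A \<subseteq> W \<Longrightarrow> embedding g A S W R"
  unfolding embedding_def by blast

lemma embedding_restrict:
  "embedding g A S V R \<Longrightarrow> B \<subseteq> A \<Longrightarrow> embedding g B S V R"
  unfolding embedding_def by (blast intro: inj_on_subset)

lemma embedding_inv_into:
  assumes "embedding h A S V R" "B \<subseteq> h ` A"
  shows "embedding (inv_into A h) B R A S"
proof -
  have "h (inv_into A h x) = x" "inv_into A h x \<in> A" if "x \<in> B" for x
    using that assms(2) by (auto simp: f_inv_into_f inv_into_into)
  moreover have "inj_on (inv_into A h) B" by (rule inj_on_inv_into) (rule assms(2))
  ultimately show ?thesis using assms(1) unfolding embedding_def by auto
qed

lemma embedding_collinear_exchange:
  assumes "embedding h A S V R" "collinear_exchange V R"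
  shows "collinear_exchange A S"
proof -
  have V: "h x \<in> V" if "x \<in> A" for x using assms(1) that unfolding embedding_def by blast
  have S: "S x y z \<longleftrightarrow> R (h x) (h y) (h z)" if "x \<in> A" "y \<in> A" "z \<in> A" for x y z
    using assms(1) that unfolding embedding_def by blast
  have neq: "h x \<noteq> h y \<longleftrightarrow> x \<noteq> y" if "x \<in> A" "y \<in> A" for x y
    using assms(1) that unfolding embedding_def by (blast dest: inj_onD)
  have hyp: "hypergraph3 V R" using assms(2) by (simp add: collinear_exchange_def)
  have "hypergraph3 A S"
    unfolding hypergraph3_def
  proof (intro ballI impI)
    fix x y z assume *: "x \<in> A" "y \<in> A" "z \<in> A" "S x y z"
    then have "R (h x) (h y) (h z)" using S by blast
    note d = hypergraph3D[OF hyp this V[OF *(1)] V[OF *(2)] V[OF *(3)]]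
    show "distinct [x, y, z] \<and> S y x z \<and> S x z y" using d S neq * by auto
  qed
  moreover have "S x z w" if "x \<in> A" "y \<in> A" "z \<in> A" "w \<in> A" "S x y z" "S x y w" "z \<noteq> w" for x y z w
  proof -
    have "R (h x) (h y) (h z)" "R (h x) (h y) (h w)" "h z \<noteq> h w" using that S neq by auto
    then have "R (h x) (h z) (h w)" using V that assms(2) unfolding collinear_exchange_def by blast
    then show ?thesis using S that by blast
  qed
  ultimately show ?thesis unfolding collinear_exchange_def by blast
qed

lemma in_K0_collinear_exchange: "in_K0 A R \<Longrightarrow> collinear_exchange A R"
  unfolding in_K0_def using linear_space_collinear_exchange by blast

lemma embedding_in_K0:
  assumes h: "embedding h A S V R" and "in_K0 V R"
  shows "in_K0 A S"
  unfolding in_K0_def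
proof (intro conjI allI impI)
  have inj: "inj_on h A" and sub: "h ` A \<subseteq> V" using h by (auto simp: embedding_def)
  show "finite A" using assms(2) sub inj unfolding in_K0_def by (metis finite_imageD finite_subset)
  show "linear_space A S"
    using embedding_collinear_exchange[OF h in_K0_collinear_exchange[OF assms(2)]]
    by (rule linear_space_if_collinear_exchange)
  fix X assume X: "X \<subseteq> A"
  then have "h ` X \<subseteq> V" using sub by blast
  then have "0 \<le> predim R (h ` X)" using assms(2) by (simp add: in_K0_def)
  then show "0 \<le> predim S X" using embedding_predim_image[OF h X] by simp
qed

text \<open>The map h carries a disjoint family of copies over f to an equally large disjoint family
  over \<open>h \<circ> f\<close>, and the bound refers to the same abstract pair in both
  structures.\<close>

lemma embedding_in_Kmu:
  assumes h: "embedding h W S' V R" and K: "in_Kmu mu V R"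
  shows "in_Kmu mu W S'"
  unfolding in_Kmu_def
proof (intro conjI allI impI)
  show "in_K0 W S'" using embedding_in_K0[OF h] K by (simp add: in_Kmu_def)
  fix B A S f F
  assume *: "good_pair B A S \<and> (\<forall>A'\<in>F. is_copy B A S f W S' A') \<and> disjoint F"
  have sub: "A' \<subseteq> W" if "A' \<in> F" for A'
    using * that unfolding is_copy_def embedding_def by blast
  have inj: "inj_on h W" using h by (simp add: embedding_def)
  have injF: "inj_on ((`) h) F"
    by (rule inj_on_subset[OF inj_on_image_Pow[OF inj]]) (use sub in auto)
  have copies: "\<forall>A'\<in>(`) h ` F. is_copy B A S (h \<circ> f) V R A'"
  proof
    fix A' assume "A' \<in> (`) h ` F"
    then obtain A0 where A0: "A0 \<in> F" "A' = h ` A0" by blast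
    then obtain g where "embedding g (B \<union> A) S W S'" "\<forall>b\<in>B. g b = f b" "A0 = g ` A"
      using * unfolding is_copy_def by blast
    then show "is_copy B A S (h \<circ> f) V R A'"
      unfolding is_copy_def using embedding_comp[OF _ h] A0
      by (intro exI[of _ "h \<circ> g"]) (auto simp: image_comp)
  qed
  have "disjoint ((`) h ` F)"
  proof (rule disjointI)
    fix a b assume "a \<in> (`) h ` F" "b \<in> (`) h ` F" "a \<noteq> b"
    then obtain a0 b0 where ab: "a0 \<in> F" "b0 \<in> F" "a = h ` a0" "b = h ` b0" "a0 \<noteq> b0" by blast
    then have "a0 \<inter> b0 = {}" using * by (auto dest: disjointD)
    then show "a \<inter> b = {}"
      using inj_on_image_Int[OF inj sub sub, OF ab(1,2)] ab by simp
  qed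
  then have "finite ((`) h ` F) \<and> card ((`) h ` F) \<le> mu B A S"
    using K * copies unfolding in_Kmu_def by blast
  then show "finite F" "card F \<le> mu B A S"
    using card_image[OF injF] finite_image_iff[OF injF] by auto
qed

section \<open>Adjoining an isolated point\<close>

text \<open>All three positions and repeated entries are covered because symmetry and irreflexivity
  of R at n are not presupposed; they are derived from this condition.\<close>

definition isolated :: "'a rel3 \<Rightarrow> 'a \<Rightarrow> 'a set \<Rightarrow> bool" where
  "isolated R n X \<longleftrightarrow> (\<forall>x\<in>insert n X. \<forall>y\<in>insert n X. \<not> R n x y \<and> \<not> R x n y \<and> \<not> R x y n)"

lemma isolated_subset: "isolated R n X \<Longrightarrow> Y \<subseteq> X \<Longrightarrow> isolated R n Y"
  unfolding isolated_def by blast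

lemma collinear_exchange_insert_isolated:
  assumes "isolated R n X" "collinear_exchange X R"
  shows "collinear_exchange (insert n X) R"
proof -
  have X: "x \<in> X \<and> y \<in> X \<and> z \<in> X"
    if "R x y z" "x \<in> insert n X" "y \<in> insert n X" "z \<in> insert n X" for x y z
    using assms(1) that unfolding isolated_def by blast
  have "hypergraph3 X R" using assms(2) by (simp add: collinear_exchange_def)
  then have "hypergraph3 (insert n X) R" using X unfolding hypergraph3_def by meson
  moreover have "R x z w" if "R x y z" "R x y w" "z \<noteq> w"
    "x \<in> insert n X" "y \<in> insert n X" "z \<in> insert n X" "w \<in> insert n X" for x y z w
    using assms(2) X[of x y z] X[of x y w] that unfolding collinear_exchange_def by blast
  ultimately show ?thesis unfolding collinear_exchange_def by blast
qed

lemma predim_insert_isolated: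
  assumes "isolated R n X" "finite X" "n \<notin> X" "collinear_exchange X R"
  shows "predim R (insert n X) = predim R X + 1"
proof -
  have "extended_lines R X n = {}"
    using assms(1) unfolding extended_lines_def is_line_def isolated_def by blast
  then show ?thesis
    using predim_insert[OF assms(2,3) collinear_exchange_insert_isolated[OF assms(1,4)]] by simp
qed

text \<open>The point n raises the predimension of every subset of X by the same amount 1, so
  comparisons between subsets are unaffected.\<close>

lemma strong_in_insert_isolated:
  assumes "isolated R n X" "finite X" "n \<notin> X" "collinear_exchange X R" and YX: "Y \<subseteq> X"
  shows "strong_in R (insert n Y) (insert n X) \<longleftrightarrow> strong_in R Y X"
proof -
  have p: "predim R (insert n Z) = predim R Z + 1" if "Z \<subseteq> X" for Z
    using predim_insert_isolated[of R n Z] isolated_subset[OF assms(1) that] that assms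
      collinear_exchange_subset[OF assms(4) that] finite_subset[OF that] by blast
  have "strong_in R (insert n Y) (insert n X)" if *: "strong_in R Y X"
    unfolding strong_in_def
  proof (intro conjI allI impI)
    fix C assume C: "finite C \<and> insert n Y \<subseteq> C \<and> C \<subseteq> insert n X"
    have CX: "C - {n} \<subseteq> X" "Y \<subseteq> C - {n}" "insert n (C - {n}) = C" "finite (C - {n})"
      using C YX assms(3) by blast+
    then have "predim R Y \<le> predim R (C - {n})" using * unfolding strong_in_def by blast
    then show "predim R (insert n Y) \<le> predim R C" using p[OF YX] p[OF CX(1)] CX(3) by simp
  qed (use YX in blast)
  moreover have "strong_in R Y X" if *: "strong_in R (insert n Y) (insert n X)"
    unfolding strong_in_def
  proof (intro conjI allI impI)
    fix C assume C: "finite C \<and> Y \<subseteq> C \<and> C \<subseteq> X"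
    then have "finite (insert n C) \<and> insert n Y \<subseteq> insert n C \<and> insert n C \<subseteq> insert n X" by blast
    then have "predim R (insert n Y) \<le> predim R (insert n C)" using * unfolding strong_in_def by blast
    then show "predim R Y \<le> predim R C" using p[OF YX] p C by simp
  qed (rule YX)
  ultimately show ?thesis by blast
qed

text \<open>
  An isolated point in the extension would lower the predimension of its complement below that of
  the base, and one in the base would be superfluous.
\<close>

lemma good_pair_no_isolated:
  assumes gp: "good_pair B A S" and m: "m \<in> B \<union> A"
  shows "\<not> isolated S m (B \<union> A - {m})"
proof
  let ?X = "B \<union> A - {m}"
  assume iso: "isolated S m ?X"
  have zp: "zero_primitive B A S" using gp by (simp add: good_pair_def)
  have K: "in_K0 (B \<union> A) S" and AB: "A \<inter> B = {}" and Ane: "A \<noteq> {}"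
    and str: "strong_in S B (B \<union> A)" and eq: "predim S (B \<union> A) = predim S B"
    and prim: "\<And>C. B \<subset> C \<Longrightarrow> C \<subset> B \<union> A \<Longrightarrow> strong_in S B C \<Longrightarrow> \<not> strong_in S C (B \<union> A)"
    using zp unfolding zero_primitive_def by auto
  have ins: "insert m ?X = B \<union> A" using m by blast
  have fin: "finite ?X" using K by (simp add: in_K0_def)
  have ce: "collinear_exchange ?X S"
    by (rule collinear_exchange_subset[OF in_K0_collinear_exchange[OF K]]) blast
  have pX: "predim S (B \<union> A) = predim S ?X + 1"
    using predim_insert_isolated[OF iso fin _ ce] ins by simp
  show False
  proof (cases "m \<in> A")
    case True
    then have "B \<subseteq> ?X" using AB by blast
    then have "predim S B \<le> predim S ?X" using str fin unfolding strong_in_def by blast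
    then show False using pX eq by simp
  next
    case False
    let ?B = "B - {m}"
    have mB: "m \<in> B" using m False by blast
    have X: "?X = ?B \<union> A" using False by blast
    have insB: "insert m ?B = B" using mB by blast
    have strong_iff: "strong_in S (insert m Y) (insert m Z) \<longleftrightarrow> strong_in S Y Z"
      if "Y \<subseteq> Z" "Z \<subseteq> ?X" for Y Z
      using strong_in_insert_isolated[OF isolated_subset[OF iso that(2)] _ _ _ that(1)]
        collinear_exchange_subset[OF ce that(2)] finite_subset[OF that(2) fin] that(2) by blast
    \<comment> \<open>Deleting m lowers all predimensions involved by 1, so strength and primitivity
      survive, against the minimality of the base B.\<close>
    have "zero_primitive ?B A S"
      unfolding zero_primitive_def X[symmetric]
    proof (intro conjI)
      show "in_K0 ?X S"
        unfolding in_K0_def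
        using fin linear_space_if_collinear_exchange[OF ce] K by (auto simp: in_K0_def)
      show "A \<inter> ?B = {}" using AB by blast
      show "A \<noteq> {}" by (rule Ane)
      show "strong_in S ?B ?X" using strong_iff[of ?B ?X] str insB ins by auto
      have "predim S B = predim S ?B + 1"
        using predim_insert_isolated[of S m ?B] isolated_subset[OF iso, of ?B]
          collinear_exchange_subset[OF ce, of ?B] finite_subset[of ?B ?X] fin insB by auto
      then show "predim S ?X = predim S ?B" using eq pX by simp
      show "\<not> (\<exists>C. ?B \<subset> C \<and> C \<subset> ?X \<and> strong_in S ?B C \<and> strong_in S C ?X)"
      proof (rule notI, elim exE conjE)
        fix C assume C: "?B \<subset> C" "C \<subset> ?X" "strong_in S ?B C" "strong_in S C ?X"
        have "strong_in S B (insert m C)" using strong_iff[of ?B C] C insB by auto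
        moreover have "strong_in S (insert m C) (B \<union> A)" using strong_iff[of C ?X] C ins by auto
        moreover have "m \<notin> C" using C by blast
        then have "B \<subset> insert m C" "insert m C \<subset> B \<union> A" using C(1,2) mB by blast+
        ultimately show False using prim by blast
      qed
    qed
    moreover have "?B \<subset> B" using mB by blast
    ultimately show False using gp unfolding good_pair_def by blast
  qed
qed

text \<open>If a copy of a good pair, base included, contained n, the preimage of n would be
  isolated in the pair, which is impossible. So all copies already lie in X, where the bound is
  known.\<close>

lemma in_Kmu_insert_isolated:
  assumes K: "in_Kmu mu X R" and iso: "isolated R n X" and n: "n \<notin> X"
  shows "in_Kmu mu (insert n X) R"
  unfolding in_Kmu_def
proof (intro conjI allI impI)
  have K0: "in_K0 X R" using K by (simp add: in_Kmu_def)
  have ce: "collinear_exchange X R" by (rule in_K0_collinear_exchange[OF K0])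
  have fin: "finite X" using K0 by (simp add: in_K0_def)
  show "in_K0 (insert n X) R"
    unfolding in_K0_def
  proof (intro conjI allI impI)
    show "finite (insert n X)" using fin by simp
    show "linear_space (insert n X) R"
      by (intro linear_space_if_collinear_exchange collinear_exchange_insert_isolated iso ce)
    fix Y assume Y: "Y \<subseteq> insert n X"
    let ?Z = "Y - {n}"
    have Z: "?Z \<subseteq> X" using Y by blast
    have "predim R (insert n ?Z) = predim R ?Z + 1"
      using predim_insert_isolated[OF isolated_subset[OF iso Z] finite_subset[OF Z fin] _
          collinear_exchange_subset[OF ce Z]] by simp
    moreover have "0 \<le> predim R ?Z" using K0 Z by (simp add: in_K0_def)
    ultimately show "0 \<le> predim R Y" by (cases "n \<in> Y") (auto simp: insert_absorb)
  qed
  fix B A S f F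
  assume *: "good_pair B A S \<and> (\<forall>A'\<in>F. is_copy B A S f (insert n X) R A') \<and> disjoint F"
  have "is_copy B A S f X R A'" if A': "A' \<in> F" for A'
  proof -
    obtain g where g: "embedding g (B \<union> A) S (insert n X) R" "\<forall>b\<in>B. g b = f b" "A' = g ` A"
      using * A' unfolding is_copy_def by blast
    have "n \<notin> g ` (B \<union> A)"
    proof
      assume "n \<in> g ` (B \<union> A)"
      then obtain m where m: "m \<in> B \<union> A" "g m = n" by blast
      have "\<not> S m x y \<and> \<not> S x m y \<and> \<not> S x y m" if "x \<in> B \<union> A" "y \<in> B \<union> A" for x y
      proof -
        have "g x \<in> insert n X" "g y \<in> insert n X" using g(1) that unfolding embedding_def by blast+
        then have "\<not> R n (g x) (g y) \<and> \<not> R (g x) n (g y) \<and> \<not> R (g x) (g y) n"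
          using iso unfolding isolated_def by blast
        then show ?thesis using g(1) that m unfolding embedding_def by blast
      qed
      then have "isolated S m (B \<union> A - {m})" using m(1) unfolding isolated_def by blast
      then show False using good_pair_no_isolated[OF _ m(1)] * by blast
    qed
    then have "g ` (B \<union> A) \<subseteq> X" using g(1) unfolding embedding_def by blast
    then have "embedding g (B \<union> A) S X R" by (rule embedding_codomain[OF g(1)])
    then show ?thesis using g(2,3) unfolding is_copy_def by blast
  qed
  then have "good_pair B A S \<and> (\<forall>A'\<in>F. is_copy B A S f X R A') \<and> disjoint F" using * by blast
  then have "finite F \<and> card F \<le> mu B A S" using K unfolding in_Kmu_def by blast
  then show "finite F" "card F \<le> mu B A S" by blast+
qed

section \<open>The generic structure\<close>

lemma generic_subset:
  assumes "is_generic mu G R" "finite A" "A \<subseteq> G"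
  shows "in_Kmu mu A R" "collinear_exchange A R"
    and "\<exists>C. finite C \<and> A \<subseteq> C \<and> strong_in R C G"
proof -
  show K: "in_Kmu mu A R" and "\<exists>C. finite C \<and> A \<subseteq> C \<and> strong_in R C G"
    using assms unfolding is_generic_def by blast+
  show "collinear_exchange A R"
    using K in_K0_collinear_exchange unfolding in_Kmu_def by blast
qed

lemma generic_amalgamate:
  fixes B :: "nat set"
  assumes "is_generic mu G R" "finite A" "strong_in R A G" "in_Kmu mu B S"
    "embedding f A R B S" "strong_in S (f ` A) B"
  obtains g where "embedding g B S G R" "\<And>a. a \<in> A \<Longrightarrow> g (f a) = a" "strong_in R (g ` B) G"
proof -
  have "\<forall>A (B :: nat set) S f.
        finite A \<and> strong_in R A G \<and> in_Kmu mu B S \<and>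
        embedding f A R B S \<and> strong_in S (f ` A) B \<longrightarrow>
        (\<exists>g. embedding g B S G R \<and> (\<forall>a\<in>A. g (f a) = a) \<and> strong_in R (g ` B) G)"
    using assms(1) unfolding is_generic_def by (elim conjE)
  from this[rule_format, of A B S f] assms(2-6)
  obtain g where "embedding g B S G R" "\<forall>a\<in>A. g (f a) = a" "strong_in R (g ` B) G" by auto
  then show thesis using that[of g] by simp
qed

lemma strong_in_mono: "strong_in R B V \<Longrightarrow> B \<subseteq> W \<Longrightarrow> W \<subseteq> V \<Longrightarrow> strong_in R B W"
  unfolding strong_in_def by blast

lemma finite_copy_nat:
  fixes R :: "'a rel3"
  assumes "finite D"
  obtains e :: "'a \<Rightarrow> nat" and S
  where "embedding e D R (e ` D) S" "embedding (inv_into D e) (e ` D) S D R"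
    "\<forall>x y z. S x y z \<longrightarrow> x \<in> e ` D \<and> y \<in> e ` D \<and> z \<in> e ` D"
proof -
  obtain e :: "'a \<Rightarrow> nat" where e: "inj_on e D" using finite_imp_inj_to_nat_seg[OF assms] by blast
  define S where "S x y z \<longleftrightarrow> x \<in> e ` D \<and> y \<in> e ` D \<and> z \<in> e ` D \<and>
    R (inv_into D e x) (inv_into D e y) (inv_into D e z)" for x y z
  have emb: "embedding e D R (e ` D) S"
    unfolding embedding_def S_def using e by (simp add: inv_into_f_f)
  show thesis
    by (rule that[OF emb embedding_inv_into[OF emb order_refl]]) (simp add: S_def)
qed

text \<open>This is homogeneity over finite strong sets. Undoing h before applying e turns the copy
  of D1 into a strong extension of the image of D under h, and amalgamation is applied over that
  image.\<close>

lemma generic_extend_embedding: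
  assumes gen: "is_generic mu G R" and D: "strong_in R D G" and D1: "finite D1" "D \<subseteq> D1" "D1 \<subseteq> G"
    and h: "embedding h D R G R" "strong_in R (h ` D) G"
  obtains g where "embedding g D1 R G R" "\<And>x. x \<in> D \<Longrightarrow> g x = h x" "strong_in R (g ` D1) G"
proof -
  obtain e :: "'a \<Rightarrow> nat" and S where e: "embedding e D1 R (e ` D1) S"
    and e': "embedding (inv_into D1 e) (e ` D1) S D1 R"
    using finite_copy_nat[OF D1(1)] .
  have K: "in_Kmu mu (e ` D1) S" by (rule embedding_in_Kmu[OF e' generic_subset(1)[OF gen D1(1,3)]])
  have finD: "finite D" using D1 finite_subset by blast
  have injh: "inj_on h D" using h(1) by (simp add: embedding_def)
  have inv: "embedding (inv_into D h) (h ` D) R D R" by (rule embedding_inv_into[OF h(1) order_refl])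
  let ?f = "e \<circ> inv_into D h"
  have f: "embedding ?f (h ` D) R (e ` D1) S"
    by (rule embedding_comp[OF inv embedding_restrict[OF e D1(2)]])
  have "?f ` h ` D = e ` D" using inv_into_image_cancel[OF injh order_refl] by (simp only: image_comp[symmetric])
  moreover have "strong_in S (e ` D) (e ` D1)"
    by (rule embedding_strong_image[OF e strong_in_mono[OF D D1(2,3)]])
  ultimately have "strong_in S (?f ` h ` D) (e ` D1)" by simp
  then obtain g where g: "embedding g (e ` D1) S G R" "\<And>a. a \<in> h ` D \<Longrightarrow> g (?f a) = a"
    "strong_in R (g ` e ` D1) G"
    using generic_amalgamate[OF gen _ h(2) K f] finD by blast
  show thesis
  proof (rule that)
    show "embedding (g \<circ> e) D1 R G R" by (rule embedding_comp[OF e g(1)])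
    show "(g \<circ> e) x = h x" if "x \<in> D" for x
      using g(2)[of "h x"] that by (simp add: inv_into_f_f[OF injh])
    show "strong_in R ((g \<circ> e) ` D1) G" using g(3) by (simp add: image_comp)
  qed
qed

lemma generic_isolated_point:
  assumes gen: "is_generic mu G R" and C: "finite C" "strong_in R C G"
  obtains a where "a \<in> G" "a \<notin> C" "isolated R a C" "strong_in R (insert a C) G"
proof -
  have CG: "C \<subseteq> G" using C(2) by (simp add: strong_in_def)
  obtain e :: "'a \<Rightarrow> nat" and S where e: "embedding e C R (e ` C) S"
    and e': "embedding (inv_into C e) (e ` C) S C R"
    and S: "\<forall>x y z. S x y z \<longrightarrow> x \<in> e ` C \<and> y \<in> e ` C \<and> z \<in> e ` C"
    by (rule finite_copy_nat[OF C(1), of R])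
  have K: "in_Kmu mu (e ` C) S" by (rule embedding_in_Kmu[OF e' generic_subset(1)[OF gen C(1) CG]])
  have fin: "finite (e ` C)" using C(1) by simp
  obtain n where n: "n \<notin> e ` C" using fin ex_new_if_finite infinite_UNIV_nat by blast
  have iso: "isolated S n (e ` C)" using S n unfolding isolated_def by blast
  have ce: "collinear_exchange (e ` C) S"
    using K in_K0_collinear_exchange unfolding in_Kmu_def by blast
  let ?B = "insert n (e ` C)"
  have KB: "in_Kmu mu ?B S" by (rule in_Kmu_insert_isolated[OF K iso n])
  have eB: "embedding e C R ?B S" using e unfolding embedding_def by blast
  have "strong_in R C C" by (rule strong_in_mono[OF C(2) order_refl CG])
  then have str: "strong_in S (e ` C) (e ` C)" by (rule embedding_strong_image[OF e])
  have "strong_in S (e ` C) ?B"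
    unfolding strong_in_def
  proof (intro conjI allI impI)
    fix Y assume Y: "finite Y \<and> e ` C \<subseteq> Y \<and> Y \<subseteq> ?B"
    then have "Y = e ` C \<or> Y = ?B" by blast
    then show "predim S (e ` C) \<le> predim S Y"
      using predim_insert_isolated[OF iso fin n ce] by auto
  qed blast
  then obtain g where g: "embedding g ?B S G R" "\<And>a. a \<in> C \<Longrightarrow> g (e a) = a" "strong_in R (g ` ?B) G"
    using generic_amalgamate[OF gen C KB eB] by blast
  \<comment> \<open>The map g undoes e on C, so the copy returns to C itself and only
    \<open>g n\<close> is new.\<close>
  have gC: "g ` e ` C = C" using g(2) by (force simp: image_iff)
  then have img: "g ` ?B = insert (g n) C" by simp
  have inj: "inj_on g ?B" using g(1) by (simp add: embedding_def)
  show thesis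
  proof (rule that)
    show "g n \<in> G" using g(1) by (auto simp: embedding_def)
    show "g n \<notin> C" using inj n gC by (metis image_eqI inj_on_image_mem_iff insertI1 subset_insertI)
    show "strong_in R (insert (g n) C) G" using g(3) img by simp
    show "isolated R (g n) C"
      unfolding isolated_def
    proof (intro ballI)
      fix x y assume "x \<in> insert (g n) C" "y \<in> insert (g n) C"
      then obtain u v where uv: "u \<in> ?B" "v \<in> ?B" "x = g u" "y = g v" using img by (metis imageE)
      have "\<not> S n u v \<and> \<not> S u n v \<and> \<not> S u v n" using iso uv unfolding isolated_def by blast
      then show "\<not> R (g n) x y \<and> \<not> R x (g n) y \<and> \<not> R x y (g n)"
        using g(1) uv unfolding embedding_def by blast
    qed
  qed
qed

section \<open>Back and forth\<close>

lemma sat_cong: "(\<And>i. i \<in> fv p \<Longrightarrow> s i = t i) \<Longrightarrow> sat V R s p \<longleftrightarrow> sat V R t p"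
proof (induction p arbitrary: s t)
  case (Ex i p)
  have "sat V R (s(i := a)) p \<longleftrightarrow> sat V R (t(i := a)) p" for a
    by (rule Ex.IH) (use Ex.prems in auto)
  then show ?case by simp
next
  case (Neg p)
  have "sat V R s p \<longleftrightarrow> sat V R t p" by (rule Neg.IH) (simp add: Neg.prems)
  then show ?case by simp
next
  case (Conj p q)
  have "sat V R s p \<longleftrightarrow> sat V R t p" by (rule Conj.IH(1)) (simp add: Conj.prems)
  moreover have "sat V R s q \<longleftrightarrow> sat V R t q" by (rule Conj.IH(2)) (simp add: Conj.prems)
  ultimately show ?case by simp
qed simp_all

text \<open>Strength is demanded of domain and image alike, so that inverses are again of this kind.
  Only the values of h on D matter.\<close>

definition strong_partial_iso :: "'a set \<Rightarrow> 'a rel3 \<Rightarrow> ('a \<Rightarrow> 'a) \<Rightarrow> 'a set \<Rightarrow> bool" where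
  "strong_partial_iso G R h D \<longleftrightarrow>
     finite D \<and> strong_in R D G \<and> embedding h D R G R \<and> strong_in R (h ` D) G"

lemma strong_partial_iso_inv:
  assumes "strong_partial_iso G R h D"
  shows "strong_partial_iso G R (inv_into D h) (h ` D)"
proof -
  have inj: "inj_on h D" and DG: "D \<subseteq> G"
    using assms by (auto simp: strong_partial_iso_def embedding_def strong_in_def)
  have img: "inv_into D h ` h ` D = D" by (rule inv_into_image_cancel[OF inj order_refl])
  have "embedding (inv_into D h) (h ` D) R D R"
    using assms by (intro embedding_inv_into[of h D R G R]) (auto simp: strong_partial_iso_def)
  then have "embedding (inv_into D h) (h ` D) R G R"
    by (rule embedding_codomain) (simp only: img DG)
  then show ?thesis using assms img by (simp add: strong_partial_iso_def)
qed

text \<open>D together with a need not be strong, so the domain is enlarged to a finite strong set E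
  containing both, over which homogeneity applies.\<close>

lemma strong_partial_iso_extend:
  assumes gen: "is_generic mu G R" and h: "strong_partial_iso G R h D" and a: "a \<in> G"
  obtains g E where "strong_partial_iso G R g E" "D \<subseteq> E" "a \<in> E" "\<forall>x\<in>D. g x = h x"
proof -
  have "finite (insert a D)" "insert a D \<subseteq> G" and D: "strong_in R D G"
    and h': "embedding h D R G R" "strong_in R (h ` D) G"
    using h a by (auto simp: strong_partial_iso_def strong_in_def)
  then obtain E where E: "finite E" "insert a D \<subseteq> E" "strong_in R E G"
    using generic_subset(3)[OF gen] by blast
  then have "D \<subseteq> E" "E \<subseteq> G" by (auto simp: strong_in_def)
  from generic_extend_embedding[OF gen D E(1) this h']
  obtain g where "embedding g E R G R" "\<And>x. x \<in> D \<Longrightarrow> g x = h x" "strong_in R (g ` E) G" by blast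
  with that[of g E] E show thesis by (auto simp: strong_partial_iso_def)
qed

text \<open>Extending the map to a witness settles the existential case, so these maps preserve all
  formulas and not just collinearity.\<close>

lemma strong_partial_iso_sat_iff:
  assumes gen: "is_generic mu G R"
  shows "strong_partial_iso G R h D \<Longrightarrow> s ` fv p \<subseteq> D \<Longrightarrow> (\<And>i. i \<in> fv p \<Longrightarrow> t i = h (s i)) \<Longrightarrow>
    sat G R s p \<longleftrightarrow> sat G R t p"
proof (induction p arbitrary: h D s t)
  case (Eq i j)
  then have "inj_on h D" by (simp add: strong_partial_iso_def embedding_def)
  then show ?case using Eq.prems by (auto simp: inj_on_eq_iff)
next
  case (Rel i j k)
  then have "embedding h D R G R" by (simp add: strong_partial_iso_def)
  then show ?case using Rel.prems by (simp add: embedding_def)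
next
  case (Neg p)
  then show ?case using Neg.IH[of h D s t] by simp
next
  case (Conj p q)
  have "s ` fv p \<subseteq> D" "s ` fv q \<subseteq> D" using Conj.prems(2) by auto
  then have "sat G R s p \<longleftrightarrow> sat G R t p" "sat G R s q \<longleftrightarrow> sat G R t q"
    by (intro Conj.IH[OF Conj.prems(1)] Conj.prems(3); simp)+
  then show ?case by simp
next
  case (Ex i p)
  \<comment> \<open>Stated for arbitrary maps: for h it gives one direction, for the inverse of h
    the other.\<close>
  have forth: "sat G R t (Ex i p)"
    if h: "strong_partial_iso G R h D" and s: "s ` (fv p - {i}) \<subseteq> D"
      and t: "\<And>j. j \<in> fv p - {i} \<Longrightarrow> t j = h (s j)" and sat: "sat G R s (Ex i p)" for h D s t
  proof -
    obtain a where a: "a \<in> G" "sat G R (s(i := a)) p" using sat by auto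
    obtain g E where g: "strong_partial_iso G R g E" "D \<subseteq> E" "a \<in> E" "\<forall>x\<in>D. g x = h x"
      using strong_partial_iso_extend[OF gen h a(1)] .
    have "sat G R (s(i := a)) p \<longleftrightarrow> sat G R (t(i := g a)) p"
    proof (rule Ex.IH[OF g(1)])
      show "(s(i := a)) ` fv p \<subseteq> E" using s g(2,3) by auto
      show "(t(i := g a)) j = g ((s(i := a)) j)" if "j \<in> fv p" for j
        using that t[of j] s g(4) by auto
    qed
    moreover have "g a \<in> G" using g(1,3) by (auto simp: strong_partial_iso_def embedding_def)
    ultimately show ?thesis using a(2) by auto
  qed
  have inj: "inj_on h D" using Ex.prems(1) by (simp add: strong_partial_iso_def embedding_def)
  have s: "s ` (fv p - {i}) \<subseteq> D" and t: "\<And>j. j \<in> fv p - {i} \<Longrightarrow> t j = h (s j)"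
    using Ex.prems(2,3) by auto
  have "t ` (fv p - {i}) \<subseteq> h ` D" using s t by force
  moreover have "s j = inv_into D h (t j)" if "j \<in> fv p - {i}" for j
    using s t[OF that] that inv_into_f_f[OF inj] by auto
  ultimately show ?case
    using forth[OF Ex.prems(1) s t] forth[OF strong_partial_iso_inv[OF Ex.prems(1)]] by blast
qed

text \<open>
  A point of the line ab satisfies this one dependency over X and no other, since a second one would
  lower the predimension below that of X.
\<close>

lemma strong_in_insert_collinear:
  assumes gen: "is_generic mu G R" and X: "finite X" "strong_in R X G"
    and ab: "a \<in> X" "b \<in> X" "a \<noteq> b" and free: "\<forall>x\<in>X. \<not> R a b x"
    and c: "c \<in> G" "R a b c"
  shows "c \<notin> X" "strong_in R (insert c X) G"
    "\<And>x y. x \<in> X \<Longrightarrow> y \<in> X \<Longrightarrow> R x y c \<longleftrightarrow> {x, y} = {a, b}"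
proof -
  show cX: "c \<notin> X" using free c(2) by blast
  have XG: "X \<subseteq> G" using X(2) by (simp add: strong_in_def)
  have fin: "finite (insert c X)" and sub: "insert c X \<subseteq> G" using X(1) XG c(1) by auto
  have ce: "collinear_exchange (insert c X) R" by (rule generic_subset(2)[OF gen fin sub])
  have ceX: "collinear_exchange X R" by (rule collinear_exchange_subset[OF ce]) blast
  have hyp: "hypergraph3 (insert c X) R" using ce by (simp add: collinear_exchange_def)
  let ?E = "extended_lines R X c"
  have pd: "predim R (insert c X) = predim R X + 1 - int (card ?E)"
    by (rule predim_insert[OF X(1) cX ce])
  have "predim R X \<le> predim R (insert c X)"
    using X(2) fin sub unfolding strong_in_def by blast
  then have card1: "card ?E \<le> 1" using pd by simp
  have finE: "finite ?E" using finite_lines[OF X(1), of R] by (simp add: extended_lines_def)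
  have thru: "line_through X R a b = {a, b}" using free by (auto simp: line_through_def)
  have ext: "line_through X R x y \<in> ?E" if "x \<in> X" "y \<in> X" "R x y c" for x y
  proof -
    have "x \<noteq> y" using hypergraph3D(1)[OF hyp that(3)] that by simp
    then have "is_line X R (line_through X R x y)" using line_through_props(1)[OF ceX] that by blast
    then show ?thesis using that unfolding extended_lines_def line_through_def by blast
  qed
  have abE: "{a, b} \<in> ?E" using ext[OF ab(1,2) c(2)] thru by simp
  then have "1 \<le> card ?E" using finE by (metis One_nat_def Suc_leI card_gt_0_iff empty_iff)
  \<comment> \<open>Joining {a, b} cancels the unit gained by the point itself, so the bound that
    makes X strong also serves for \<open>insert c X\<close>.\<close>
  then have le: "predim R (insert c X) \<le> predim R X" using pd by simp
  show "strong_in R (insert c X) G"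
    unfolding strong_in_def
  proof (intro conjI allI impI)
    fix Y assume Y: "finite Y \<and> insert c X \<subseteq> Y \<and> Y \<subseteq> G"
    then have "predim R X \<le> predim R Y" using X(2) unfolding strong_in_def by blast
    then show "predim R (insert c X) \<le> predim R Y" using le by simp
  qed (rule sub)
  fix x y assume xy: "x \<in> X" "y \<in> X"
  show "R x y c \<longleftrightarrow> {x, y} = {a, b}"
  proof
    assume R: "R x y c"
    have "line_through X R x y = {a, b}"
      using ext[OF xy R] abE card1 finE by (metis card_le_Suc0_iff_eq One_nat_def)
    moreover have "x \<noteq> y" using hypergraph3D(1)[OF hyp R] xy by simp
    moreover have "x \<in> line_through X R x y" "y \<in> line_through X R x y" by (auto simp: line_through_def)
    ultimately show "{x, y} = {a, b}" by auto
  next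
    assume "{x, y} = {a, b}"
    then have "x = a \<and> y = b \<or> x = b \<and> y = a" by (auto simp: doubleton_eq_iff)
    then show "R x y c" using c(2) hypergraph3D(4)[OF hyp c(2)] ab by auto
  qed
qed

text \<open>The points c and d have the same collinearities with X, namely those with the pair {a,
  b}, and both enlarged sets are strong.\<close>

lemma strong_partial_iso_swap_collinear:
  assumes gen: "is_generic mu G R" and X: "finite X" "strong_in R X G"
    and ab: "a \<in> X" "b \<in> X" "a \<noteq> b" and free: "\<forall>x\<in>X. \<not> R a b x"
    and c: "c \<in> G" "R a b c" and d: "d \<in> G" "R a b d"
  shows "strong_partial_iso G R (id(c := d)) (insert c X)"
proof -
  note C = strong_in_insert_collinear[OF gen X ab free c]
  note D = strong_in_insert_collinear[OF gen X ab free d]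
  have XG: "X \<subseteq> G" using X(2) by (simp add: strong_in_def)
  let ?h = "id(c := d)"
  have "?h ` X = id ` X" by (rule image_cong) (use C(1) in auto)
  then have img: "?h ` insert c X = insert d X" by (simp only: image_insert) simp
  have inj: "inj_on ?h (insert c X)" using C(1) D(1) by (auto simp: inj_on_def)
  have hc: "hypergraph3 (insert c X) R"
    using generic_subset(2)[OF gen, of "insert c X"] X(1) XG c(1) by (simp add: collinear_exchange_def)
  have hd: "hypergraph3 (insert d X) R"
    using generic_subset(2)[OF gen, of "insert d X"] X(1) XG d(1) by (simp add: collinear_exchange_def)
  have last: "R x y c \<longleftrightarrow> R x y d" if "x \<in> X" "y \<in> X" for x y
    using C(3)[OF that] D(3)[OF that] by simp
  have perm: "R x u y \<longleftrightarrow> R x y u" "R u x y \<longleftrightarrow> R x y u"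
    if hyp: "hypergraph3 (insert u X) R" and xy: "x \<in> X" "y \<in> X" for u x y
  proof -
    have V: "x \<in> insert u X" "y \<in> insert u X" "u \<in> insert u X" using xy by auto
    show "R x u y \<longleftrightarrow> R x y u"
      using hypergraph3D(5)[OF hyp _ V(1,2,3)] hypergraph3D(5)[OF hyp _ V(1,3,2)] by blast
    show "R u x y \<longleftrightarrow> R x y u"
      using hypergraph3D(7)[OF hyp _ V(1,2,3)] hypergraph3D(6)[OF hyp _ V(3,1,2)] by blast
  qed
  have irr: "\<not> R x u u" "\<not> R u x u" "\<not> R u u x"
    if hyp: "hypergraph3 (insert u X) R" and "x \<in> insert u X" for u x
    using hypergraph3D(1)[OF hyp, of u u x] hypergraph3D(2)[OF hyp, of u x u]
      hypergraph3D(3)[OF hyp, of x u u] that(2) by blast+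
  \<comment> \<open>A single occurrence of c is moved to the last place by symmetry; with two or
    more occurrences both sides are false.\<close>
  have "R x y z \<longleftrightarrow> R (?h x) (?h y) (?h z)"
    if xyz: "x \<in> insert c X" "y \<in> insert c X" "z \<in> insert c X" for x y z
    using xyz C(1) last perm[OF hc] perm[OF hd] irr[OF hc] irr[OF hd]
    by (cases "x = c"; cases "y = c"; cases "z = c") simp_all
  then have "embedding ?h (insert c X) R G R"
    unfolding embedding_def using inj img XG d(1) by auto
  then show ?thesis
    unfolding strong_partial_iso_def using X(1) C(2) D(2) img by simp
qed

section \<open>Transfer to the generic structure\<close>

abbreviation Forall :: "nat \<Rightarrow> fm \<Rightarrow> fm" where
  "Forall i p \<equiv> Neg (Ex i (Neg p))"

abbreviation Imp :: "fm \<Rightarrow> fm \<Rightarrow> fm" where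
  "Imp p q \<equiv> Neg (Conj p (Neg q))"

text \<open>Applied to all free variables, this trades parameters for existential quantifiers and
  yields a sentence, which can be moved between structures.\<close>

definition exs :: "nat list \<Rightarrow> fm \<Rightarrow> fm" where
  "exs is p = foldr Ex is p"

lemma fv_exs: "fv (exs is p) = fv p - set is"
  by (induction "is") (auto simp: exs_def)

lemma sat_exs_intro:
  "range s \<subseteq> V \<Longrightarrow> sat V R s p \<Longrightarrow> sat V R s (exs is p)"
proof (induction "is")
  case (Cons i "is")
  then have "\<exists>a\<in>V. sat V R (s(i := a)) (exs is p)" by (intro bexI[of _ "s i"]) auto
  then show ?case by (simp add: exs_def)
qed (simp add: exs_def)

lemma sat_exs_elim:
  assumes "sat V R s (exs is p)" "range s \<subseteq> V"
  obtains t where "range t \<subseteq> V" "sat V R t p"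
proof -
  have "range s \<subseteq> V \<Longrightarrow> sat V R s (exs is p) \<Longrightarrow> \<exists>t. range t \<subseteq> V \<and> sat V R t p" for s
  proof (induction "is" arbitrary: s)
    case (Cons i "is")
    then obtain a where "a \<in> V" "sat V R (s(i := a)) (exs is p)" by (auto simp: exs_def)
    moreover have "range (s(i := a)) \<subseteq> V" using Cons.prems(1) \<open>a \<in> V\<close> by auto
    ultimately show ?case using Cons.IH by blast
  qed (auto simp: exs_def)
  then show thesis using assms that by blast
qed

lemma finite_fv: "finite (fv p)"
  by (induction p) auto

text \<open>The theory of a structure is complete: if p failed in G, its negation would belong to
  the theory and hold in M, and the nonempty M has an assignment at which both would be
  true.\<close>

lemma sentence_transfer:
  assumes "is_model M R (theory_of G RG)" "holds M R p" "fv p = {}"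
  shows "holds G RG p"
proof (rule ccontr)
  assume "\<not> holds G RG p"
  then obtain s where "range s \<subseteq> G" "\<not> sat G RG s p" by (auto simp: holds_def)
  then have "\<not> sat G RG t p" for t using sat_cong[of p s t G RG] assms(3) by simp
  then have "Neg p \<in> theory_of G RG" using assms(3) by (simp add: theory_of_def holds_def)
  then have N: "holds M R (Neg p)" and "M \<noteq> {}" using assms(1) unfolding is_model_def by auto
  then obtain m where "m \<in> M" by blast
  then have "range (\<lambda>_. m) \<subseteq> M" by auto
  then show False using N assms(2) unfolding holds_def by (meson sat.simps(3))
qed

lemma steiner_quasigroup_not_projection:
  assumes st: "steiner_system k M R" and inf: "infinite M"
    and line: "\<forall>a\<in>M. \<forall>b\<in>M. \<forall>l. is_line M R l \<and> a \<in> l \<and> b \<in> l \<longrightarrow> f a b \<in> l"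
    and qg: "quasigroup_on M f" and ab: "a \<in> M" "b \<in> M" "a \<noteq> b"
  shows "f a b \<noteq> a" "f a b \<noteq> b"
proof -
  have ls: "linear_space M R" and lf: "\<And>l. is_line M R l \<Longrightarrow> finite l"
    using st by (auto simp: steiner_system_def)
  have join: "\<exists>!l. is_line M R l \<and> x \<in> l \<and> y \<in> l" if "x \<in> M" "y \<in> M" "x \<noteq> y" for x y
    using ls that unfolding linear_space_def by blast
  have idem: "f x x = x" if x: "x \<in> M" for x
  proof (rule ccontr)
    assume ne: "f x x \<noteq> x"
    have fx: "f x x \<in> M" using qg x unfolding quasigroup_on_def by blast
    obtain l where l: "is_line M R l" "x \<in> l" "f x x \<in> l" using join[OF x fx ne[symmetric]] by blast
    obtain y where y: "y \<in> M" "y \<notin> l" using lf[OF l(1)] inf by (metis finite_subset subsetI)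
    have "x \<noteq> y" using y l by blast
    then obtain m where m: "is_line M R m" "x \<in> m" "y \<in> m" using join[OF x y(1)] by blast
    \<comment> \<open>With both arguments equal to x, the hypothesis \<open>line\<close> places the
      product on every line through x.\<close>
    then have "f x x \<in> m" using line x by blast
    then have "l = m" using join[OF x fx ne[symmetric]] l m by blast
    then show False using y m by blast
  qed
  \<comment> \<open>From \<open>f a b = a = f a a\<close>, cancelling a on the left gives b = a; in
    the other case \<open>f a b = b = f b b\<close> is cancelled on the right.\<close>
  show "f a b \<noteq> a" using qg ab idem unfolding quasigroup_on_def by metis
  show "f a b \<noteq> b" using qg ab idem unfolding quasigroup_on_def by metis
qed

text \<open>
  The fresh variable v names the value, so that its uniqueness can be expressed without
  substituting into p.
\<close>

definition line_function_fm :: "nat \<Rightarrow> fm \<Rightarrow> fm" where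
  "line_function_fm v p = Forall 0 (Forall 1 (Imp (Neg (Eq 0 1))
     (Ex v (Conj (Rel 0 1 v) (Conj (Ex 2 (Conj (Rel 0 1 2) (Neg (Eq 2 v))))
        (Forall 2 (Conj (Imp p (Eq 2 v)) (Imp (Eq 2 v) p))))))))"

lemma sat_line_function_fm:
  assumes "v \<notin> fv p" "v > 2"
  shows "sat V R s (line_function_fm v p) \<longleftrightarrow>
    (\<forall>a\<in>V. \<forall>b\<in>V. a \<noteq> b \<longrightarrow> (\<exists>c\<in>V. R a b c \<and> (\<exists>d\<in>V. R a b d \<and> d \<noteq> c) \<and>
       (\<forall>d\<in>V. sat V R (s(0 := a, 1 := b, 2 := d)) p \<longleftrightarrow> d = c)))"
proof -
  have *: "sat V R (s(0 := a, Suc 0 := b, v := c, 2 := d)) p \<longleftrightarrow>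
      sat V R (s(0 := a, Suc 0 := b, 2 := d)) p" for a b c d
    by (rule sat_cong) (use assms in auto)
  \<comment> \<open>Splits the equivalence into the two implications encoded by \<open>Imp\<close>,
    the second with d already replaced by c.\<close>
  have **: "(sat V R (s(0 := a, Suc 0 := b, 2 := d)) p \<longleftrightarrow> d = c) \<longleftrightarrow>
      (sat V R (s(0 := a, Suc 0 := b, 2 := d)) p \<longrightarrow> d = c) \<and>
      (d = c \<longrightarrow> sat V R (s(0 := a, Suc 0 := b, 2 := c)) p)" for a b c d
    by auto
  have v: "v \<noteq> 0" "v \<noteq> Suc 0" "v \<noteq> 2" using assms(2) by auto
  show ?thesis
    unfolding line_function_fm_def using v
    by (simp add: * ** disj_imp)
qed

text \<open>Letting C contain the values of all free variables keeps the parameters in the part that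
  the swap fixes, and choosing b isolated over C and a leaves their line in that part with two
  points only.\<close>

lemma generic_no_line_function:
  assumes gen: "is_generic mu G R" and s: "range s \<subseteq> G" and v: "v \<notin> fv p" "v > 2"
  shows "\<not> sat G R s (line_function_fm v p)"
proof
  assume sat: "sat G R s (line_function_fm v p)"
  have "finite (s ` fv p)" "s ` fv p \<subseteq> G" using finite_fv s by auto
  from generic_subset(3)[OF gen this]
  obtain C where C: "finite C" "s ` fv p \<subseteq> C" "strong_in R C G" by blast
  obtain a where a: "a \<in> G" "a \<notin> C" "isolated R a C" "strong_in R (insert a C) G"
    using generic_isolated_point[OF gen C(1,3)] .
  have fa: "finite (insert a C)" using C(1) by simp
  obtain b where b: "b \<in> G" "b \<notin> insert a C" "isolated R b (insert a C)"
    "strong_in R (insert b (insert a C)) G"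
    using generic_isolated_point[OF gen fa a(4)] .
  let ?X = "insert b (insert a C)"
  have ab: "a \<in> ?X" "b \<in> ?X" "a \<noteq> b" and fX: "finite ?X" using b C(1) by auto
  have free: "\<forall>x\<in>?X. \<not> R a b x" using b(3) unfolding isolated_def by blast
  obtain c d where c: "c \<in> G" "R a b c" and d: "d \<in> G" "R a b d" "d \<noteq> c"
    and def: "\<And>d. d \<in> G \<Longrightarrow> sat G R (s(0 := a, 1 := b, 2 := d)) p \<longleftrightarrow> d = c"
    using sat[unfolded sat_line_function_fm[OF v]] a(1) b(1) ab(3) by blast
  have iso: "strong_partial_iso G R (id(c := d)) (insert c ?X)"
    by (rule strong_partial_iso_swap_collinear[OF gen fX b(4) ab free c d(1,2)])
  have "c \<notin> ?X" using free c(2) by blast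
  \<comment> \<open>The swap moves c alone, and c lies outside the set holding a, b and the
    parameters, so it carries the first assignment to the second on the free variables of p.\<close>
  then have "sat G R (s(0 := a, 1 := b, 2 := c)) p \<longleftrightarrow> sat G R (s(0 := a, 1 := b, 2 := d)) p"
    using C(2) by (intro strong_partial_iso_sat_iff[OF gen iso]) auto
  then show False using def c(1) d(1,3) by blast
qed

theorem theorem5p13:
  fixes mu :: mu_fun
    and G :: "'g set" and RG :: "'g rel3"
    and M :: "'a set" and R :: "'a rel3"
    and f :: "'a \<Rightarrow> 'a \<Rightarrow> 'a"
  assumes "iso_invariant mu"
    and "is_generic mu G RG"
    and "is_model M R (theory_of G RG)"
    and "strongly_minimal M R"
    and "steiner_system (mu_alpha mu + 2) M R"
    and "mu_alpha mu \<ge> 2"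
    and "\<forall>a\<in>M. \<forall>b\<in>M. \<forall>l. is_line M R l \<and> a \<in> l \<and> b \<in> l \<longrightarrow> f a b \<in> l"
    and "quasigroup_on M f"
    and "\<forall>l. is_line M R l \<longrightarrow> (\<forall>a\<in>l. \<forall>b\<in>l. a \<noteq> b \<longrightarrow> generated f {a, b} = l)"
  shows "\<not> definable_op M R f"
proof
  assume "definable_op M R f"
  then obtain p s where s: "range s \<subseteq> M"
    and p: "\<forall>a\<in>M. \<forall>b\<in>M. \<forall>c\<in>M.
      f a b = c \<longleftrightarrow> sat M R (s(0 := a, 1 := b, 2 := c)) p"
    unfolding definable_op_def by blast
  have inf: "infinite M" using assms(4) by (simp add: strongly_minimal_def minimal_structure_def)
  have "finite (fv p \<union> {..2})" using finite_fv by simp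
  then obtain v where "v \<notin> fv p \<union> {..2}" using ex_new_if_finite infinite_UNIV_nat by blast
  then have v: "v \<notin> fv p" "v > 2" by auto
  have "sat M R s (line_function_fm v p)"
    unfolding sat_line_function_fm[OF v]
  proof (intro ballI impI)
    fix a b assume ab: "a \<in> M" "b \<in> M" "a \<noteq> b"
    let ?c = "f a b"
    have "\<exists>!l. is_line M R l \<and> a \<in> l \<and> b \<in> l"
      using assms(5) ab unfolding steiner_system_def linear_space_def by blast
    then obtain l where l: "is_line M R l" "a \<in> l" "b \<in> l" by blast
    then have clq: "clique R l" and lM: "l \<subseteq> M" by (auto simp: is_line_def)
    have card: "finite l" "card l \<ge> 4" using assms(5,6) l(1) by (auto simp: steiner_system_def)
    have cl: "?c \<in> l" using assms(7) ab l by blast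
    have ne: "?c \<noteq> a" "?c \<noteq> b"
      by (rule steiner_quasigroup_not_projection[OF assms(5) inf assms(7,8) ab])+
    \<comment> \<open>A line has \<open>mu_alpha mu + 2\<close> points, hence at least four, so a, b
      and their product do not exhaust it; a remaining point is the second candidate.\<close>
    have "card {a, b, ?c} \<le> 3" by (simp add: card_insert_if)
    then have "\<not> l \<subseteq> {a, b, ?c}" using card card_mono[of "{a, b, ?c}" l] by auto
    then obtain d where d: "d \<in> l" "d \<noteq> a" "d \<noteq> b" "d \<noteq> ?c" by blast
    have "R a b ?c" "R a b d" using cliqueD[OF clq l(2,3)] cl ne d ab(3) by metis+
    moreover have "\<forall>e\<in>M. sat M R (s(0 := a, 1 := b, 2 := e)) p \<longleftrightarrow> e = ?c"
      using p[rule_format, OF ab(1,2)] by auto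
    ultimately show "\<exists>c\<in>M. R a b c \<and> (\<exists>d\<in>M. R a b d \<and> d \<noteq> c) \<and>
        (\<forall>d\<in>M. sat M R (s(0 := a, 1 := b, 2 := d)) p \<longleftrightarrow> d = c)"
      using cl d lM by (intro bexI[of _ ?c]) auto
  qed
  moreover obtain vs where vs: "set vs = fv (line_function_fm v p)"
    using finite_list[OF finite_fv] by blast
  ultimately have sat: "sat M R s (exs vs (line_function_fm v p))"
    using sat_exs_intro[OF s] by blast
  have closed: "fv (exs vs (line_function_fm v p)) = {}" by (simp add: fv_exs vs)
  then have "holds M R (exs vs (line_function_fm v p))"
    unfolding holds_def using sat sat_cong by (metis empty_iff)
  then have G: "holds G RG (exs vs (line_function_fm v p))"
    by (rule sentence_transfer[OF assms(3) _ closed])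
  \<comment> \<open>Evaluating the sentence in G requires an assignment, hence an element of G; an
    isolated point over some finite strong set provides one.\<close>
  obtain C where "finite C" "strong_in RG C G"
    using generic_subset(3)[OF assms(2), of "{}"] by blast
  then obtain g where "g \<in> G"
    using generic_isolated_point[OF assms(2)] by blast
  then have r: "range (\<lambda>_. g) \<subseteq> G" by auto
  then have "sat G RG (\<lambda>_. g) (exs vs (line_function_fm v p))" using G by (simp add: holds_def)
  then obtain t where "range t \<subseteq> G" "sat G RG t (line_function_fm v p)"
    using sat_exs_elim r by blast
  then show False using generic_no_line_function[OF assms(2) _ v] by blast
qed

end
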